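(* Let $I=(0,\rho)$ with $0<\rho\le\infty$, and let $N\ge2$ be a fixed integer. For $\alpha\in\mathbb{R}$ define $f:I\to\mathbb{R}$ by $f(x)=x^\alpha$. (a) For $N=2$: $f_\diamond(A)\in\mathbb{P}_2$ for all $A\in\mathbb{P}_2(I)$ if and only if $\alpha\ge0$. (b) For $N\ge3$: for each $\alpha<N-2$ that is not a nonnegative integer, there exists $A\in\mathbb{P}_N(I)$ such that $f_\diamond(A)\notin\mathbb{P}_N$.
   Context: Matrices in $\mathbb{C}^{N\times N}$ are indexed by $(i,j)\in\mathcal{K}_{N,N}:=\{0,\dots,N-1\}^2$; put $\mathcal{K}^*_{N,N}:=\mathcal{K}_{N,N}\setminus\{(0,0)\}$. A matrix $A$ with $A^*=A$ is positive semidefinite if $z^*Az\ge 0$ for all $z\in\mathbb{C}^N$. $\mathbb{P}_N(\Omega)$ is the set of $N\times N$ positive semidefinite matrices with entries in $\Omega$, and $\mathbb{P}_N:=\mathbb{P}_N(\mathbb{C})$. For $\ell\ge1$ and $(i,j)\in\mathcal{K}^*_{N,N}$, $\mathcal{P}^*_\ell(i,j)$ is the set of all multisets $S$ of $\ell$ elements (counted with multiplicity) of $\mathcal{K}^*_{N,N}$ with $\sum_{(p,q)\in S}(p,q)=(i,j)$; $c_S(m,n)$ is the multiplicity of $(m,n)$ in $S$. For a function $f:I\to\mathbb{R}$ that is $2N-2$ times differentiable and $A=(a_{ij})\in I^{N\times N}$, the matrix $f_\diamond(A)\in\mathbb{R}^{N\times N}$ is defined by $(f_\diamond(A))_{00}:=f(a_{00})$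 and, for $(i,j)\in\mathcal{K}^*_{N,N}$, $$(f_\diamond(A))_{ij}:=\sum_{\ell=1}^{i+j}f^{(\ell)}(a_{00})\sum_{S\in\mathcal{P}^*_\ell(i,j)}\frac{1}{\prod_{(m,n)\in\mathcal{K}^*_{N,N}}c_S(m,n)!}\prod_{(p,q)\in S}a_{p,q},$$ products over $S$ being taken with multiplicity. *)

theory Defs
  imports
    "HOL-Analysis.Analysis"
    "HOL-Library.Multiset"
    "Jordan_Normal_Form.Schur_Decomposition"
begin

(* HOL-Analysis uses $ and \<bullet> for its own type-indexed vectors. *)
hide_const (open) Finite_Cartesian_Product.mat Finite_Cartesian_Product.row
  Finite_Cartesian_Product.vec Finite_Cartesian_Product.vec_nth
  Finite_Cartesian_Product.vec_lambda Determinants.det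
no_notation Finite_Cartesian_Product.vec_nth (infixl \<open>$\<close> 90)
no_notation Inner_Product.real_inner_class.inner (infixl \<open>\<bullet>\<close> 70)

(* The order on complex numbers is the one of Complex_Order: 0 \<le> w says that w is real and
   nonnegative. *)
definition positive_semidefinite :: "nat \<Rightarrow> complex mat \<Rightarrow> bool" where
  "positive_semidefinite N A \<longleftrightarrow>
     A \<in> carrier_mat N N \<and> mat_adjoint A = A \<and>
     (\<forall>z \<in> carrier_vec N. conjugate z \<bullet> (A *\<^sub>v z) \<ge> 0)"

definition psd_mats :: "nat \<Rightarrow> complex set \<Rightarrow> complex mat set" where
  "psd_mats N \<Omega> = {A. positive_semidefinite N A \<and> elements_mat A \<subseteq> \<Omega>}"

definition index_set :: "nat \<Rightarrow> (nat \<times> nat) set" where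
  "index_set N = {0..<N} \<times> {0..<N}"

definition index_set_star :: "nat \<Rightarrow> (nat \<times> nat) set" where
  "index_set_star N = index_set N - {(0, 0)}"

(* Pairs are added componentwise (Product_Plus). *)
definition vector_partitions ::
    "nat \<Rightarrow> nat \<Rightarrow> nat \<times> nat \<Rightarrow> (nat \<times> nat) multiset set" where
  "vector_partitions N l ij =
     {S. size S = l \<and> set_mset S \<subseteq> index_set_star N \<and> sum_mset S = ij}"

lemma finite_index_set_star: "finite (index_set_star N)"
  by (simp add: index_set_star_def index_set_def)

lemma finite_vector_partitions: "finite (vector_partitions N l ij)"
proof -
  let ?L = "{xs. set xs \<subseteq> index_set_star N \<and> length xs = l}"
  have "vector_partitions N l ij \<subseteq> mset ` ?L"
  proof
    fix S assume S: "S \<in> vector_partitions N l ij"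
    obtain xs where "mset xs = S" using ex_mset by blast
    with S show "S \<in> mset ` ?L" by (auto simp: vector_partitions_def)
  qed
  moreover have "finite ?L"
    by (rule finite_lists_length_eq[OF finite_index_set_star])
  ultimately show ?thesis by (rule finite_subset[OF _ finite_imageI])
qed

(* A function on an open interval I is represented by an arbitrary extension to all reals. The
   iterated derivatives are taken at A $$ (0,0) \<in> I only, so they do not depend on the
   extension; they are meaningful when f is 2 * N - 2 times differentiable on I. *)
definition f_diamond :: "nat \<Rightarrow> (real \<Rightarrow> real) \<Rightarrow> real mat \<Rightarrow> real mat" where
  "f_diamond N f A = mat N N (\<lambda>(i, j).
     if (i, j) = (0, 0) then f (A $$ (0, 0))
     else \<Sum>l = 1..i + j. (deriv ^^ l) f (A $$ (0, 0)) *
            (\<Sum>S \<in> vector_partitions N l (i, j).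
               1 / (\<Prod>mn \<in> index_set_star N. fact (count S mn)) *
               (\<Prod>pq \<in># S. A $$ pq)))"

end

(* If A = diag(t, t, 0, ..., 0), the generating polynomial of A is t + t x y, so the (j,j) entry of
   f_diamond(A) is the j-th Taylor coefficient of f at t times t^j. Unless alpha is a nonnegative
   integer, the first negative Taylor coefficient of x^alpha has index 1 if alpha < 0 and index
   floor(alpha) + 2 otherwise, which is less than N exactly in the range considered. Since the (j,j)
   entry is polynomial in the remaining entries of A, it stays negative when the zero entries of A
   are replaced by a small d > 0, which makes all entries positive and keeps A positive
   semidefinite. The remaining implication, for N = 2, follows from the identity
   det f_diamond(A) = alpha * a00^(2 alpha - 2) * det A. *)

theory Submission
  imports Defs
begin

section \<open>Positive semidefiniteness of real matrices\<close>

lemma conjugate_quadratic_form: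
  assumes "A \<in> carrier_mat N N" "z \<in> carrier_vec N"
  shows "conjugate z \<bullet> (map_mat complex_of_real A *\<^sub>v z) =
    (\<Sum>i<N. \<Sum>j<N. cnj (z $ i) * of_real (A $$ (i, j)) * z $ j)"
  using assms
  by (auto simp: scalar_prod_def sum_distrib_left mult.assoc lessThan_atLeast0 intro!: sum.cong)

text \<open>For real symmetric matrices, the form at \<open>x + \<i> y\<close> is the sum of the forms at \<open>x\<close> and \<open>y\<close>.\<close>

lemma positive_semidefinite_of_real_iff:
  assumes A: "A \<in> carrier_mat N N"
  shows "positive_semidefinite N (map_mat complex_of_real A) \<longleftrightarrow>
    (\<forall>i<N. \<forall>j<N. A $$ (i, j) = A $$ (j, i)) \<and>
    (\<forall>x. 0 \<le> (\<Sum>i<N. \<Sum>j<N. x i * A $$ (i, j) * x j))" (is "?L \<longleftrightarrow> ?sym \<and> ?pos")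
proof -
  let ?B = "map_mat complex_of_real A"
  have sym: "mat_adjoint ?B = ?B \<longleftrightarrow> ?sym"
  proof -
    have e: "mat_adjoint ?B $$ (i, j) = of_real (A $$ (j, i))" if "i < N" "j < N" for i j
      using that A by (simp add: mat_adjoint_def mat_of_rows_def)
    have d: "mat_adjoint ?B \<in> carrier_mat N N"
      using A by (simp add: mat_adjoint_def mat_of_rows_def)
    show ?thesis
    proof
      assume "mat_adjoint ?B = ?B"
      then show ?sym using e A
        by (metis carrier_matD index_map_mat(1) of_real_eq_iff)
    next
      assume ?sym
      then show "mat_adjoint ?B = ?B"
        using d A e by (intro eq_matI) auto
    qed
  qed
  have form: "(\<Sum>i<N. \<Sum>j<N. cnj (z i) * of_real (A $$ (i, j)) * z j) =
      of_real ((\<Sum>i<N. \<Sum>j<N. Re (z i) * A $$ (i, j) * Re (z j)) +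
        (\<Sum>i<N. \<Sum>j<N. Im (z i) * A $$ (i, j) * Im (z j)))" if ?sym for z :: "nat \<Rightarrow> complex"
  proof (rule complex_eqI)
    have re: "Re (cnj (z i) * of_real (A $$ (i, j)) * z j) =
        Re (z i) * A $$ (i, j) * Re (z j) + Im (z i) * A $$ (i, j) * Im (z j)" for i j
      by simp
    have im: "Im (cnj (z i) * of_real (A $$ (i, j)) * z j) =
        Re (z i) * A $$ (i, j) * Im (z j) - Im (z i) * A $$ (i, j) * Re (z j)" for i j
      by simp
    show "Re (\<Sum>i<N. \<Sum>j<N. cnj (z i) * of_real (A $$ (i, j)) * z j) =
      Re (of_real ((\<Sum>i<N. \<Sum>j<N. Re (z i) * A $$ (i, j) * Re (z j)) +
        (\<Sum>i<N. \<Sum>j<N. Im (z i) * A $$ (i, j) * Im (z j))))"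
      by (simp only: Re_sum re sum.distrib Re_complex_of_real)
    \<comment> \<open>Interchanging the two indices and using symmetry shows that the mixed sums
      agree, so the imaginary part cancels.\<close>
    have "(\<Sum>i<N. \<Sum>j<N. Im (z i) * A $$ (i, j) * Re (z j)) =
        (\<Sum>i<N. \<Sum>j<N. Im (z j) * A $$ (j, i) * Re (z i))"
      by (rule sum.swap)
    also have "\<dots> = (\<Sum>i<N. \<Sum>j<N. Re (z i) * A $$ (i, j) * Im (z j))"
      using that by (intro sum.cong refl) (simp add: mult.commute mult.left_commute)
    finally show "Im (\<Sum>i<N. \<Sum>j<N. cnj (z i) * of_real (A $$ (i, j)) * z j) =
      Im (of_real ((\<Sum>i<N. \<Sum>j<N. Re (z i) * A $$ (i, j) * Re (z j)) +
        (\<Sum>i<N. \<Sum>j<N. Im (z i) * A $$ (i, j) * Im (z j))))"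
      by (simp only: Im_sum im sum_subtractf Im_complex_of_real diff_self)
  qed
  have "(\<forall>z \<in> carrier_vec N. conjugate z \<bullet> (?B *\<^sub>v z) \<ge> 0) \<longleftrightarrow> ?pos" if s: ?sym
  proof
    assume h: "\<forall>z \<in> carrier_vec N. conjugate z \<bullet> (?B *\<^sub>v z) \<ge> 0"
    show ?pos
    proof
      fix x :: "nat \<Rightarrow> real"
      let ?z = "Matrix.vec N (\<lambda>i. complex_of_real (x i))"
      have z: "?z \<in> carrier_vec N" by simp
      have "0 \<le> (\<Sum>i<N. \<Sum>j<N. cnj (?z $ i) * of_real (A $$ (i, j)) * ?z $ j)"
        using h z unfolding conjugate_quadratic_form[OF A z, symmetric] by blast
      also have "\<dots> = complex_of_real (\<Sum>i<N. \<Sum>j<N. x i * A $$ (i, j) * x j)"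
        by simp
      finally show "0 \<le> (\<Sum>i<N. \<Sum>j<N. x i * A $$ (i, j) * x j)"
        by (simp add: less_eq_complex_def)
    qed
  next
    assume p: ?pos
    show "\<forall>z \<in> carrier_vec N. conjugate z \<bullet> (?B *\<^sub>v z) \<ge> 0"
    proof
      fix z :: "complex Matrix.vec" assume z: "z \<in> carrier_vec N"
      have "conjugate z \<bullet> (?B *\<^sub>v z) =
        of_real ((\<Sum>i<N. \<Sum>j<N. Re (z $ i) * A $$ (i, j) * Re (z $ j)) +
          (\<Sum>i<N. \<Sum>j<N. Im (z $ i) * A $$ (i, j) * Im (z $ j)))"
        unfolding conjugate_quadratic_form[OF A z] by (rule form[OF s])
      moreover have "0 \<le> (\<Sum>i<N. \<Sum>j<N. Re (z $ i) * A $$ (i, j) * Re (z $ j)) +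
          (\<Sum>i<N. \<Sum>j<N. Im (z $ i) * A $$ (i, j) * Im (z $ j))"
        by (intro add_nonneg_nonneg p[rule_format])
      ultimately show "conjugate z \<bullet> (?B *\<^sub>v z) \<ge> 0"
        by (simp only: less_eq_complex_def Re_complex_of_real Im_complex_of_real
            zero_complex.simps simp_thms)
    qed
  qed
  then show ?thesis
    using A sym by (auto simp: positive_semidefinite_def)
qed

text \<open>Test the form on the j-th unit vector. A single negative diagonal entry therefore
  refutes semidefiniteness.\<close>

lemma psd_diagonal_nonneg:
  assumes psd: "positive_semidefinite N (map_mat complex_of_real A)"
    and A: "A \<in> carrier_mat N N" and "j < N"
  shows "0 \<le> A $$ (j, j)"
proof -
  let ?x = "\<lambda>i. if i = j then 1 else (0::real)"
  have "0 \<le> (\<Sum>i<N. \<Sum>k<N. ?x i * A $$ (i, k) * ?x k)"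
    by (rule psd[unfolded positive_semidefinite_of_real_iff[OF A], THEN conjunct2, rule_format])
  also have "\<dots> = (\<Sum>i<N. \<Sum>k<N. if k = j then if i = j then A $$ (j, j) else 0 else 0)"
    by (intro sum.cong refl) simp
  also have "\<dots> = A $$ (j, j)"
    using \<open>j < N\<close> by simp
  finally show ?thesis .
qed

text \<open>Completing the square, a times the form is (a x0 + b x1)^2 + (a c - b^2) x1^2. Since a >
  0, the sign of the form is the sign of this expression.\<close>

lemma positive_semidefinite_2_of_real_iff:
  assumes A: "A \<in> carrier_mat 2 2" and pos: "0 < A $$ (0, 0)"
  shows "positive_semidefinite 2 (map_mat complex_of_real A) \<longleftrightarrow>
    A $$ (0, 1) = A $$ (1, 0) \<and> (A $$ (0, 1))\<^sup>2 \<le> A $$ (0, 0) * A $$ (1, 1)"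
proof -
  define a b c where abc: "a = A $$ (0, 0)" "b = A $$ (0, 1)" "c = A $$ (1, 1)"
  have form: "(\<Sum>i<2. \<Sum>j<2. x i * A $$ (i, j) * x j) =
      a * (x 0)\<^sup>2 + 2 * b * x 0 * x 1 + c * (x 1)\<^sup>2" if "A $$ (0, 1) = A $$ (1, 0)" for x
    using that by (simp add: numeral_2_eq_2 abc power2_eq_square algebra_simps)
  have nonneg: "(\<forall>x::nat \<Rightarrow> real. 0 \<le> a * (x 0)\<^sup>2 + 2 * b * x 0 * x 1 + c * (x 1)\<^sup>2) \<longleftrightarrow> b\<^sup>2 \<le> a * c"
  proof
    assume "\<forall>x::nat \<Rightarrow> real. 0 \<le> a * (x 0)\<^sup>2 + 2 * b * x 0 * x 1 + c * (x 1)\<^sup>2"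
    \<comment> \<open>The vector (b, -a) makes the completed square vanish and leaves only the
      determinant term.\<close>
    from this[rule_format, of "\<lambda>i. if i = 0 then b else - a"]
    have "0 \<le> a * (a * c - b\<^sup>2)" by (simp add: power2_eq_square algebra_simps)
    with pos show "b\<^sup>2 \<le> a * c" by (simp add: zero_le_mult_iff abc)
  next
    assume le: "b\<^sup>2 \<le> a * c"
    show "\<forall>x::nat \<Rightarrow> real. 0 \<le> a * (x 0)\<^sup>2 + 2 * b * x 0 * x 1 + c * (x 1)\<^sup>2"
    proof
      fix x :: "nat \<Rightarrow> real"
      have "a * (a * (x 0)\<^sup>2 + 2 * b * x 0 * x 1 + c * (x 1)\<^sup>2) =
          (a * x 0 + b * x 1)\<^sup>2 + (a * c - b\<^sup>2) * (x 1)\<^sup>2"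
        by (simp add: power2_eq_square algebra_simps)
      also have "\<dots> \<ge> 0" using le by simp
      finally show "0 \<le> a * (x 0)\<^sup>2 + 2 * b * x 0 * x 1 + c * (x 1)\<^sup>2"
        using pos by (simp add: zero_le_mult_iff abc)
    qed
  qed
  have sym: "(\<forall>i<2. \<forall>j<2. A $$ (i, j) = A $$ (j, i)) \<longleftrightarrow> A $$ (0, 1) = A $$ (1, 0)"
    by (auto simp: numeral_2_eq_2 less_Suc_eq)
  show ?thesis
  proof (cases "A $$ (0, 1) = A $$ (1, 0)")
    case True
    show ?thesis
      unfolding positive_semidefinite_of_real_iff[OF A] sym form[OF True] nonneg
      by (simp only: abc)
  next
    case False
    then show ?thesis
      unfolding positive_semidefinite_of_real_iff[OF A] sym by blast
  qed
qed

section \<open>Iterated derivatives of powers\<close>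

lemma higher_deriv_powr:
  assumes "0 < x"
  shows "(deriv ^^ l) (\<lambda>x. x powr \<alpha>) x = (\<Prod>i<l. \<alpha> - real i) * x powr (\<alpha> - real l)"
  using assms
proof (induction l arbitrary: x)
  case (Suc l)
  \<comment> \<open>Differentiating once more requires the induction hypothesis on a whole
    neighbourhood of x, not only at x.\<close>
  have "\<forall>\<^sub>F y in nhds x. 0 < y"
    using eventually_nhds_in_open[of "{0<..}" x] Suc.prems by simp
  then have "\<forall>\<^sub>F y in nhds x.
      (deriv ^^ l) (\<lambda>x. x powr \<alpha>) y = (\<Prod>i<l. \<alpha> - real i) * y powr (\<alpha> - real l)"
    by eventually_elim (rule Suc.IH)
  then have "(deriv ^^ Suc l) (\<lambda>x. x powr \<alpha>) x =
      deriv (\<lambda>y. (\<Prod>i<l. \<alpha> - real i) * y powr (\<alpha> - real l)) x"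
    by (simp add: deriv_cong_ev)
  also have "\<dots> = (\<Prod>i<l. \<alpha> - real i) * ((\<alpha> - real l) * x powr (\<alpha> - real l - 1))"
    using Suc.prems by (intro DERIV_imp_deriv) (auto intro!: derivative_eq_intros)
  finally show ?case by (simp add: algebra_simps)
qed simp

section \<open>Entries of \<open>f_diamond\<close>: continuity and the diagonal\<close>

lemma f_diamond_carrier [simp]: "f_diamond N f A \<in> carrier_mat N N"
  by (simp add: f_diamond_def)

lemma f_diamond_index:
  assumes "i < N" "j < N" "(i, j) \<noteq> (0, 0)"
  shows "f_diamond N f A $$ (i, j) = (\<Sum>l = 1..i + j. (deriv ^^ l) f (A $$ (0, 0)) *
    (\<Sum>S \<in> vector_partitions N l (i, j).
      1 / (\<Prod>mn \<in> index_set_star N. fact (count S mn)) * (\<Prod>pq \<in># S. A $$ pq)))"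
  using assms by (auto simp: f_diamond_def)

lemma tendsto_prod_mset:
  fixes f :: "'a \<Rightarrow> 'b \<Rightarrow> 'c :: real_normed_field"
  assumes "\<And>x. x \<in># S \<Longrightarrow> ((\<lambda>d. f d x) \<longlongrightarrow> g x) F"
  shows "((\<lambda>d. \<Prod>x\<in>#S. f d x) \<longlongrightarrow> (\<Prod>x\<in>#S. g x)) F"
  using assms by (induction S) (auto intro!: tendsto_mult)

text \<open>With the (0, 0) entry held fixed, the derivatives of f are constants, and each entry is
  a polynomial in the other entries of the matrix.\<close>

lemma f_diamond_tendsto:
  assumes "\<And>d. A d $$ (0, 0) = B $$ (0, 0)"
    and "\<And>p. p \<in> index_set_star N \<Longrightarrow> ((\<lambda>d. A d $$ p) \<longlongrightarrow> B $$ p) F"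
    and "i < N" "j < N"
  shows "((\<lambda>d. f_diamond N f (A d) $$ (i, j)) \<longlongrightarrow> f_diamond N f B $$ (i, j)) F"
proof (cases "(i, j) = (0, 0)")
  case True
  then show ?thesis using assms by (simp add: f_diamond_def)
next
  case False
  show ?thesis
    unfolding f_diamond_index[OF assms(3,4) False] assms(1)
    by (intro tendsto_sum tendsto_mult tendsto_const tendsto_prod_mset assms(2))
      (auto simp: vector_partitions_def)
qed

lemma sum_mset_replicate_diagonal: "sum_mset (replicate_mset l (1, 1)) = (l, l :: nat)"
  by (induction l) (auto simp: zero_prod_def)

text \<open>Every multiset containing a pair other than (1, 1) has a zero factor in its product.
  What survives is the multiset of j copies of (1, 1), which occurs only for l = j.\<close>

lemma f_diamond_diagonal:
  assumes B: "\<And>p. p \<in> index_set_star N \<Longrightarrow> B $$ p = (if p = (1, 1) then e else 0)"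
    and j: "1 \<le> j" "j < N"
  shows "f_diamond N f B $$ (j, j) = (deriv ^^ j) f (B $$ (0, 0)) * e ^ j / fact j"
proof -
  let ?R = "replicate_mset j (1, 1 :: nat)"
  have N: "(1, 1) \<in> index_set_star N" using j by (auto simp: index_set_star_def index_set_def)
  have inner: "(\<Sum>S \<in> vector_partitions N l (j, j).
               1 / (\<Prod>mn \<in> index_set_star N. fact (count S mn)) * (\<Prod>pq \<in># S. B $$ pq)) =
      (if l = j then e ^ j / fact j else 0)" for l
  proof -
    have zero: "(\<Prod>pq \<in># S. B $$ pq) = 0"
      if S: "S \<in> vector_partitions N l (j, j)" and ne: "S \<noteq> ?R" for S
    proof -
      have "\<exists>p \<in># S. p \<noteq> (1, 1)"
      proof (rule ccontr)
        assume "\<not> (\<exists>p \<in># S. p \<noteq> (1, 1))"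
        \<comment> \<open>The sum of such an S is (\<open>size S\<close>, \<open>size S\<close>).
          Comparing with (j, j) gives \<open>size S\<close> = j and hence S =
          \<open>?R\<close>.\<close>
        then have "S = replicate_mset (size S) (1, 1)"
          by (metis set_mset_subset_singletonD insertI1 subsetI)
        then show False
          using S ne sum_mset_replicate_diagonal[of "size S"] by (auto simp: vector_partitions_def)
      qed
      then show ?thesis
        using S B by (force simp: vector_partitions_def)
    qed
    have R: "?R \<in> vector_partitions N l (j, j) \<longleftrightarrow> l = j"
      using N sum_mset_replicate_diagonal[of j] j by (auto simp: vector_partitions_def)
    \<comment> \<open>All pairs except (1, 1) have multiplicity 0 and contribute 0! = 1.\<close>
    have "(\<Prod>mn \<in> index_set_star N. fact (count ?R mn)) =
        (\<Prod>mn \<in> index_set_star N. if mn = (1, 1) then fact j else (1::real))"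
      by (intro prod.cong) auto
    then have fact: "(\<Prod>mn \<in> index_set_star N. fact (count ?R mn)) = (fact j :: real)"
      using N by (simp add: finite_index_set_star)
    have "(\<Sum>S \<in> vector_partitions N l (j, j).
               1 / (\<Prod>mn \<in> index_set_star N. fact (count S mn)) * (\<Prod>pq \<in># S. B $$ pq)) =
      (\<Sum>S \<in> vector_partitions N l (j, j). if S = ?R then e ^ j / fact j else 0)"
      using zero fact B[OF N] by (intro sum.cong refl) auto
    then show ?thesis
      using R by (simp add: finite_vector_partitions)
  qed
  have "f_diamond N f B $$ (j, j) =
      (\<Sum>l = 1..j + j. if l = j then (deriv ^^ j) f (B $$ (0, 0)) * (e ^ j / fact j) else 0)"
    using j by (subst f_diamond_index, (simp; fail)+, unfold inner)
      (simp add: if_distrib[of "(*) _"] cong: if_cong)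
  then show ?thesis using j by simp
qed

section \<open>Counterexamples from a negative derivative\<close>

lemma not_preserved_if_negative_deriv:
  fixes I :: "real set"
  assumes I: "\<And>x. 0 < x \<Longrightarrow> x \<le> t \<Longrightarrow> x \<in> I" and t: "0 < t"
    and j: "1 \<le> j" "j < N" and neg: "(deriv ^^ j) f t < 0"
  shows "\<exists>A. map_mat complex_of_real A \<in> psd_mats N (complex_of_real ` I) \<and>
    map_mat complex_of_real (f_diamond N f A) \<notin> psd_mats N UNIV"
proof -
  \<comment> \<open>At d = 0 this is diag(t, t, 0, ..., 0), whose zero entries lie outside an
    interval of positive numbers. A small d > 0 repairs this, and the (0, 0) entry stays at t for
    all d, as the limit argument requires.\<close>
  define A where "A d = mat N N (\<lambda>p. if p \<in> {(0, 0), (1, 1)} then t else d)" for d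
  have N: "0 < N" "1 < N" using j by auto
  have entry: "A d $$ p = (if p = (1, 1) then t else d)" if "p \<in> index_set_star N" for d p
    using that by (cases p) (auto simp: A_def index_set_star_def index_set_def)
  have A00: "A d $$ (0, 0) = t" for d using N by (simp add: A_def)
  have "((\<lambda>d. f_diamond N f (A d) $$ (j, j)) \<longlongrightarrow> f_diamond N f (A 0) $$ (j, j)) (at_right 0)"
  proof (rule f_diamond_tendsto)
    show "((\<lambda>d. A d $$ p) \<longlongrightarrow> A 0 $$ p) (at_right 0)" if "p \<in> index_set_star N" for p
      using that by (simp add: entry tendsto_ident_at)
  qed (use j A00 in auto)
  moreover have "f_diamond N f (A 0) $$ (j, j) < 0"
  proof -
    have "f_diamond N f (A 0) $$ (j, j) = (deriv ^^ j) f (A 0 $$ (0, 0)) * t ^ j / fact j"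
      by (rule f_diamond_diagonal) (use j in \<open>simp_all add: entry\<close>)
    then show ?thesis
      using neg t A00 by (simp add: divide_neg_pos mult_neg_pos)
  qed
  ultimately have "\<forall>\<^sub>F d in at_right 0. f_diamond N f (A d) $$ (j, j) < 0"
    by (rule order_tendstoD(2))
  moreover have "\<forall>\<^sub>F d in at_right 0. d \<in> {0<..<t}"
    using t by (rule eventually_at_right_real)
  ultimately have "\<forall>\<^sub>F d in at_right 0. f_diamond N f (A d) $$ (j, j) < 0 \<and> d \<in> {0<..<t}"
    by (rule eventually_conj)
  from eventually_happens'[OF trivial_limit_at_right_real this]
  obtain d where d: "0 < d" "d < t" and neg: "f_diamond N f (A d) $$ (j, j) < 0"
    unfolding greaterThanLessThan_iff by blast
  have Ac: "A d \<in> carrier_mat N N" by (simp add: A_def)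
  have "positive_semidefinite N (map_mat complex_of_real (A d))"
    unfolding positive_semidefinite_of_real_iff[OF Ac]
  proof (intro conjI allI impI)
    fix x :: "nat \<Rightarrow> real"
    \<comment> \<open>\<open>A d\<close> is d times the all-ones matrix plus t - d at the first two
      diagonal positions. Its form is thus d times the square of the coordinate sum plus the
      nonnegative terms \<open>g i\<close>.\<close>
    define g where "g i = (if i \<in> {0, 1} then (t - d) * (x i)\<^sup>2 else 0)" for i
    have "(\<Sum>i<N. \<Sum>k<N. x i * A d $$ (i, k) * x k) =
        (\<Sum>i<N. \<Sum>k<N. d * (x i * x k) + (if i = k then g i else 0))"
      by (intro sum.cong refl) (auto simp: A_def g_def power2_eq_square algebra_simps)
    also have "\<dots> = d * (\<Sum>i<N. x i)\<^sup>2 + (\<Sum>i<N. g i)"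
      unfolding power2_eq_square sum_product unfolding sum_distrib_left by (simp add: sum.distrib)
    also have "\<dots> \<ge> 0"
      using d by (intro add_nonneg_nonneg sum_nonneg mult_nonneg_nonneg) (auto simp: g_def)
    finally show "0 \<le> (\<Sum>i<N. \<Sum>k<N. x i * A d $$ (i, k) * x k)" .
  qed (auto simp: A_def)
  moreover have "elements_mat (map_mat complex_of_real (A d)) \<subseteq> complex_of_real ` I"
  proof -
    have "t \<in> I" "d \<in> I" using I[of t] I[of d] d t by simp_all
    then have "A d $$ (i, k) \<in> I" if "i < N" "k < N" for i k
      using that by (simp add: A_def)
    then show ?thesis using Ac by (auto simp: elements_mat_def)
  qed
  moreover have "\<not> positive_semidefinite N (map_mat complex_of_real (f_diamond N f (A d)))"
    using psd_diagonal_nonneg[OF _ f_diamond_carrier j(2)] neg linorder_not_le by blast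
  ultimately show ?thesis by (auto simp: psd_mats_def)
qed

text \<open>For \<alpha> < 0 the single factor \<alpha> is negative. Otherwise take factors until
  exactly one of them, the last, is negative; as \<alpha> is not an integer, none is zero. The bound
  m + 1 becomes N - 1, the last diagonal index, when m = N - 2.\<close>

lemma negative_falling_factorial:
  assumes "\<alpha> < real m" "\<alpha> \<notin> \<nat>"
  obtains j where "1 \<le> j" "j \<le> m + 1" "(\<Prod>i<j. \<alpha> - real i) < 0"
proof (cases "\<alpha> < 0")
  case True
  then show ?thesis by (intro that[of 1]) auto
next
  case False
  \<comment> \<open>The factors for i = 0, ..., k are positive and the one for i = k + 1 is
    negative, so j = k + 2. From k < m it follows that j is at most m + 1.\<close>
  define k where "k = nat \<lfloor>\<alpha>\<rfloor>"
  have k: "real k \<le> \<alpha>" "\<alpha> < real k + 1" using False by (auto simp: k_def)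
  have "real k \<noteq> \<alpha>" using assms(2) by auto
  with k have k: "real k < \<alpha>" "\<alpha> < real (Suc k)" by auto
  have "(\<Prod>i<Suc k. \<alpha> - real i) > 0"
    using k by (intro prod_pos) auto
  then have "(\<Prod>i<Suc (Suc k). \<alpha> - real i) < 0"
    unfolding prod.lessThan_Suc[of _ "Suc k"] using k by (intro mult_pos_neg) auto
  moreover have "Suc (Suc k) \<le> m + 1" using k assms(1) by linarith
  ultimately show ?thesis using False by (intro that[of "Suc (Suc k)"]) auto
qed

section \<open>The case N = 2\<close>

lemma vector_partitions_1:
  assumes "ij \<in> index_set_star N"
  shows "vector_partitions N (Suc 0) ij = {{#ij#}}"
proof -
  have "S = {#ij#}" if "S \<in> vector_partitions N (Suc 0) ij" for S
  proof -
    have "size S = 1" using that by (simp add: vector_partitions_def)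
    then obtain p where "S = {#p#}"
      using size_1_singleton_mset by blast
    then show ?thesis using that by (simp add: vector_partitions_def)
  qed
  then show ?thesis using assms by (auto simp: vector_partitions_def)
qed

lemma index_set_star_2: "index_set_star 2 = {(0, 1), (1, 0), (1, 1)}"
  by (auto simp: index_set_star_def index_set_def)

text \<open>A part (1, 1) would force the other part to be (0, 0), which is excluded; so the parts
  are the two unit vectors, once each.\<close>

lemma vector_partitions_2_2: "vector_partitions 2 2 (1, 1) = {{#(0, 1), (1, 0)#}}"
proof -
  have "S = {#(0, 1), (1, 0)#}" if "S \<in> vector_partitions 2 2 (1, 1)" for S
  proof -
    have "size S = Suc (Suc 0)" using that by (simp add: vector_partitions_def)
    then obtain p T where T: "S = add_mset p T" "size T = Suc 0"
      by (metis size_eq_Suc_imp_eq_union size_add_mset nat.inject)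
    then obtain q where S: "S = {#p, q#}"
      using size_1_singleton_mset[of T] by auto
    show ?thesis
      using that by (auto simp: S vector_partitions_def index_set_star_2 add_mset_commute)
  qed
  then show ?thesis by (auto simp: vector_partitions_def index_set_star_2)
qed

text \<open>The second derivative carries no factor 1/2, because the two parts of the only
  contributing multiset are distinct.\<close>

lemma f_diamond_2:
  assumes "A \<in> carrier_mat 2 2"
  shows "f_diamond 2 f A $$ (0, 0) = f (A $$ (0, 0))"
    and "f_diamond 2 f A $$ (0, 1) = deriv f (A $$ (0, 0)) * A $$ (0, 1)"
    and "f_diamond 2 f A $$ (1, 0) = deriv f (A $$ (0, 0)) * A $$ (1, 0)"
    and "f_diamond 2 f A $$ (1, 1) = deriv f (A $$ (0, 0)) * A $$ (1, 1) +
      deriv (deriv f) (A $$ (0, 0)) * (A $$ (0, 1) * A $$ (1, 0))"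
proof -
  have [simp]: "(\<Prod>mn \<in> index_set_star 2. fact (count S mn)) =
      fact (count S (0, 1)) * (fact (count S (1, 0)) * (fact (count S (1, 1)) :: real))" for S
    by (simp add: index_set_star_2)
  have [simp]: "vector_partitions 2 (Suc 0) (0, Suc 0) = {{#(0, 1)#}}"
    "vector_partitions 2 (Suc 0) (Suc 0, 0) = {{#(1, 0)#}}"
    "vector_partitions 2 (Suc 0) (Suc 0, Suc 0) = {{#(1, 1)#}}"
    by (simp_all add: vector_partitions_1 index_set_star_2)
  have deriv2: "(deriv ^^ 2) f = deriv (deriv f)" by (simp add: numeral_2_eq_2)
  have "{1..1 + 1::nat} = {1, 2}" by auto
  then show "f_diamond 2 f A $$ (1, 1) = deriv f (A $$ (0, 0)) * A $$ (1, 1) +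
      deriv (deriv f) (A $$ (0, 0)) * (A $$ (0, 1) * A $$ (1, 0))"
    using vector_partitions_2_2
    by (simp add: f_diamond_index numeral_2_eq_2[symmetric] deriv2)
  show "f_diamond 2 f A $$ (0, 1) = deriv f (A $$ (0, 0)) * A $$ (0, 1)"
    "f_diamond 2 f A $$ (1, 0) = deriv f (A $$ (0, 0)) * A $$ (1, 0)"
    by (simp_all add: f_diamond_index)
qed (simp add: f_diamond_def)

lemma f_diamond_powr_2_preserves_psd:
  fixes I :: "real set"
  assumes \<alpha>: "0 \<le> \<alpha>" and I: "I \<subseteq> {0<..}"
    and "map_mat complex_of_real A \<in> psd_mats 2 (complex_of_real ` I)"
  shows "map_mat complex_of_real (f_diamond 2 (\<lambda>x. x powr \<alpha>) A) \<in> psd_mats 2 UNIV"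
proof -
  let ?f = "\<lambda>x. x powr \<alpha>" and ?a = "A $$ (0, 0)" and ?b = "A $$ (0, 1)" and ?c = "A $$ (1, 1)"
  have psd: "positive_semidefinite 2 (map_mat complex_of_real A)"
    and el: "elements_mat (map_mat complex_of_real A) \<subseteq> complex_of_real ` I"
    using assms(3) by (auto simp: psd_mats_def)
  then have A: "A \<in> carrier_mat 2 2" by (simp add: positive_semidefinite_def)
  then have "complex_of_real ?a \<in> elements_mat (map_mat complex_of_real A)"
    by (force simp: elements_mat_def)
  with el have "complex_of_real ?a \<in> complex_of_real ` I" by blast
  with I have a: "0 < ?a" by auto
  then have sym: "A $$ (1, 0) = ?b" and det: "?b\<^sup>2 \<le> ?a * ?c"
    using psd positive_semidefinite_2_of_real_iff[OF A] by auto
  have d1: "deriv ?f ?a = \<alpha> * ?a powr (\<alpha> - 1)"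
    using higher_deriv_powr[OF a, of 1] by simp
  have d2: "deriv (deriv ?f) ?a = \<alpha> * (\<alpha> - 1) * ?a powr (\<alpha> - 2)"
    using higher_deriv_powr[OF a, of 2] by (simp add: numeral_2_eq_2)
  \<comment> \<open>Taking out this common power turns the three powers of \<open>?a\<close> into r,
    r a and r a^2, so that the determinant identity becomes polynomial algebra.\<close>
  define r where "r = ?a powr (\<alpha> - 2)"
  have "0 < r" using a by (simp add: r_def)
  have r: "?a powr \<alpha> = r * ?a\<^sup>2" "?a powr (\<alpha> - 1) = r * ?a"
    using a by (auto simp: r_def powr_diff power2_eq_square field_simps)
  have "(\<alpha> * (r * ?a) * ?b)\<^sup>2 \<le> r * ?a\<^sup>2 * (\<alpha> * (r * ?a) * ?c + \<alpha> * (\<alpha> - 1) * r * (?b * ?b))"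
  proof -
    have "r * ?a\<^sup>2 * (\<alpha> * (r * ?a) * ?c + \<alpha> * (\<alpha> - 1) * r * (?b * ?b)) - (\<alpha> * (r * ?a) * ?b)\<^sup>2
        = \<alpha> * (r * ?a)\<^sup>2 * (?a * ?c - ?b\<^sup>2)"
      by (simp add: power2_eq_square algebra_simps)
    also have "\<dots> \<ge> 0" using \<alpha> det by simp
    finally show ?thesis by simp
  qed
  \<comment> \<open>The criterion for 2 by 2 matrices applies because the (0, 0) entry of the image
    is r a^2 > 0.\<close>
  then have "positive_semidefinite 2 (map_mat complex_of_real (f_diamond 2 ?f A))"
    using a \<open>0 < r\<close> by (subst positive_semidefinite_2_of_real_iff)
      (auto simp: f_diamond_2[OF A, of ?f] sym d1 d2 r r_def[symmetric] simp del: One_nat_def)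
  then show ?thesis by (simp add: psd_mats_def)
qed

theorem theorem5:
  fixes \<rho> :: ereal and I :: "real set"
  assumes "0 < \<rho>"
    and "I = {x. 0 < x \<and> ereal x < \<rho>}"
  shows "(\<forall>\<alpha>::real.
            (\<forall>A::real mat. map_mat complex_of_real A \<in> psd_mats 2 (complex_of_real ` I) \<longrightarrow>
               map_mat complex_of_real (f_diamond 2 (\<lambda>x. x powr \<alpha>) A) \<in> psd_mats 2 UNIV)
            \<longleftrightarrow> \<alpha> \<ge> 0)
       \<and> (\<forall>N::nat. N \<ge> 3 \<longrightarrow>
            (\<forall>\<alpha>::real. \<alpha> < real N - 2 \<and> \<alpha> \<notin> \<nat> \<longrightarrow>
               (\<exists>A::real mat. map_mat complex_of_real A \<in> psd_mats N (complex_of_real ` I) \<and>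
                  map_mat complex_of_real (f_diamond N (\<lambda>x. x powr \<alpha>) A) \<notin> psd_mats N UNIV)))"
proof -
  \<comment> \<open>As \<rho> may be infinite, a finite t below it is chosen; all of (0, t] then
    lies in \<open>I\<close>.\<close>
  obtain t where t: "0 < t" "ereal t < \<rho>"
    using ereal_dense2[OF assms(1)] by (auto simp: zero_ereal_def)
  have I: "x \<in> I" if "0 < x" "x \<le> t" for x
    using that t(2) assms(2) by (auto intro: le_less_trans[of _ "ereal t"])
  \<comment> \<open>Allowing N = 2 lets the same construction serve part (b) and the necessity of
    \<alpha> \<ge> 0 in part (a), where the bound N - 2 is 0.\<close>
  have counterexample: "\<exists>A. map_mat complex_of_real A \<in> psd_mats N (complex_of_real ` I) \<and>
      map_mat complex_of_real (f_diamond N (\<lambda>x. x powr \<alpha>) A) \<notin> psd_mats N UNIV"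
    if N: "N \<ge> 2" and \<alpha>: "\<alpha> < real (N - 2)" "\<alpha> \<notin> \<nat>" for N \<alpha>
  proof -
    obtain j where j: "1 \<le> j" "j \<le> N - 2 + 1" "(\<Prod>i<j. \<alpha> - real i) < 0"
      using negative_falling_factorial[OF \<alpha>] by blast
    \<comment> \<open>A power of t is positive, so the derivative has the sign of the falling
      factorial.\<close>
    then have "(deriv ^^ j) (\<lambda>x. x powr \<alpha>) t < 0"
      using t(1) by (simp add: higher_deriv_powr mult_neg_pos)
    then show ?thesis
      using j N I t(1) by (intro not_preserved_if_negative_deriv[of t I j]) auto
  qed
  have "\<alpha> \<ge> 0" if "\<forall>A::real mat. map_mat complex_of_real A \<in> psd_mats 2 (complex_of_real ` I) \<longrightarrow>
      map_mat complex_of_real (f_diamond 2 (\<lambda>x. x powr \<alpha>) A) \<in> psd_mats 2 UNIV" for \<alpha>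
  proof (rule ccontr)
    assume "\<not> \<alpha> \<ge> 0"
    then have "\<alpha> < real (2 - 2)" "\<alpha> \<notin> \<nat>" by (auto elim: Nats_cases)
    then show False using counterexample[of 2 \<alpha>] that by blast
  qed
  moreover have "I \<subseteq> {0<..}" using assms(2) by auto
  ultimately show ?thesis
    using f_diamond_powr_2_preserves_psd[of _ I] counterexample by (auto simp: of_nat_diff)
qed

end
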